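(* Let $X$ be a real normed vector space, let $f:X\to\mathbb{R}$ be a real-valued function and let $k>0$. The following are equivalent: (a) $f$ is Lipschitz continuous on the whole space $X$ with Lipschitz constant $k$; (b) each minimal convex majorant of $f$ is real-valued and Lipschitz continuous on $X$ with Lipschitz constant not exceeding $k$; (c) each maximal concave minorant of $f$ is real-valued and Lipschitz continuous on $X$ with Lipschitz constant not exceeding $k$.
   Context: $\overline{\mathbb{R}}=\mathbb{R}\cup\{\pm\infty\}$. A function $f$ is Lipschitz continuous with Lipschitz constant $k$ if $|f(x)-f(y)|\le k\|x-y\|$ for all $x,y\in X$. A function $g:X\to\overline{\mathbb{R}}$ is convex if $g(x)>-\infty$ for all $x\in X$ and its epigraph $\{(x,\alpha)\in X\times\mathbb{R}: g(x)\le\alpha\}$ is a nonempty convex set; $h$ is concave if $-h$ is convex. A convex majorant of $f$ is a convex function $g:X\to\overline{\mathbb{R}}$ with $f\le g$ pointwise on $X$; a minimal convex majorant of $f$ is a convex majorant that is minimal, for the pointwise ordering, among all convex majorants of $f$. A concave minorant of $f$ is a concave function $h:X\to\overline{\mathbb{R}}$ with $h\le f$ pointwise on $X$; a maximal concave minorant of $f$ is a concave minorant that is maximal, for the pointwise ordering, among all concave minorants of $f$. *)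

theory Defs
  imports "HOL-Analysis.Analysis"
begin

(* The library's epigraph and convex_on are restricted to real-valued functions;
   the following are the versions for functions into the extended reals. *)

definition ereal_epigraph :: "('a \<Rightarrow> ereal) \<Rightarrow> ('a \<times> real) set" where
  "ereal_epigraph g = {(x, \<alpha>). g x \<le> ereal \<alpha>}"

(* Nonemptiness of the epigraph excludes the constant function with value infinity. *)
definition ereal_convex :: "('a::real_vector \<Rightarrow> ereal) \<Rightarrow> bool" where
  "ereal_convex g \<longleftrightarrow>
     (\<forall>x. g x > -\<infinity>) \<and> ereal_epigraph g \<noteq> {} \<and> convex (ereal_epigraph g)"

definition ereal_concave :: "('a::real_vector \<Rightarrow> ereal) \<Rightarrow> bool" where
  "ereal_concave h \<longleftrightarrow> ereal_convex (\<lambda>x. - h x)"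

definition convex_majorant :: "('a::real_vector \<Rightarrow> real) \<Rightarrow> ('a \<Rightarrow> ereal) \<Rightarrow> bool" where
  "convex_majorant f g \<longleftrightarrow> ereal_convex g \<and> (\<forall>x. ereal (f x) \<le> g x)"

definition concave_minorant :: "('a::real_vector \<Rightarrow> real) \<Rightarrow> ('a \<Rightarrow> ereal) \<Rightarrow> bool" where
  "concave_minorant f h \<longleftrightarrow> ereal_concave h \<and> (\<forall>x. h x \<le> ereal (f x))"

definition minimal_convex_majorant :: "('a::real_vector \<Rightarrow> real) \<Rightarrow> ('a \<Rightarrow> ereal) \<Rightarrow> bool" where
  "minimal_convex_majorant f g \<longleftrightarrow>
     convex_majorant f g \<and> (\<forall>g'. convex_majorant f g' \<and> g' \<le> g \<longrightarrow> g' = g)"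

definition maximal_concave_minorant :: "('a::real_vector \<Rightarrow> real) \<Rightarrow> ('a \<Rightarrow> ereal) \<Rightarrow> bool" where
  "maximal_concave_minorant f h \<longleftrightarrow>
     concave_minorant f h \<and> (\<forall>h'. concave_minorant f h' \<and> h \<le> h' \<longrightarrow> h' = h)"

definition real_valued_lipschitz_le :: "real \<Rightarrow> ('a::real_normed_vector \<Rightarrow> ereal) \<Rightarrow> bool" where
  "real_valued_lipschitz_le k g \<longleftrightarrow>
     (\<exists>r::'a \<Rightarrow> real. (\<forall>x. g x = ereal (r x)) \<and> (\<exists>L\<le>k. L-lipschitz_on UNIV r))"

end

(* The infimal convolution of a convex majorant g with k * norm is again convex, and it still
   majorizes f when f is k-Lipschitz; minimality then forces g x \<le> g y + k * norm (x - y).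
   Conversely, the function equal to f z at z and infinite elsewhere is a convex majorant, so by
   Zorn there is a minimal convex majorant touching f at z; its Lipschitz bound passes to f.
   The concave case follows by negation. *)

theory Submission
  imports Defs
begin

section \<open>Convexity of extended-real functions and of their infima\<close>

lemma convex_ereal_epigraphD:
  assumes "convex (ereal_epigraph g)" "g x \<le> ereal a" "g y \<le> ereal b"
    and "0 \<le> u" "0 \<le> v" "u + v = 1"
  shows "g (u *\<^sub>R x + v *\<^sub>R y) \<le> ereal (u * a + v * b)"
  using convexD[OF assms(1), of "(x, a)" "(y, b)" u v] assms(2-)
  by (simp add: ereal_epigraph_def)

text \<open>An infimum need not be attained, so points of its epigraph are first raised by e to
  obtain indices i and j, and e is let go to 0 at the end. The hypothesis \<open>step\<close> lets
  the index l depend on all the data, which covers both a chain of functions, where l is the smaller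
  of two members, and an infimal convolution, where l is a convex combination of base
  points.\<close>

lemma convex_ereal_epigraph_INF:
  fixes \<phi> :: "'i \<Rightarrow> 'a::real_vector \<Rightarrow> ereal"
  assumes step: "\<And>i j x y a b u v. i \<in> I \<Longrightarrow> j \<in> I \<Longrightarrow> \<phi> i x \<le> ereal a \<Longrightarrow> \<phi> j y \<le> ereal b \<Longrightarrow>
    0 \<le> u \<Longrightarrow> 0 \<le> v \<Longrightarrow> u + v = 1 \<Longrightarrow>
    \<exists>l\<in>I. \<phi> l (u *\<^sub>R x + v *\<^sub>R y) \<le> ereal (u * a + v * b)"
  shows "convex (ereal_epigraph (\<lambda>x. INF i\<in>I. \<phi> i x))"
proof -
  have "(INF i\<in>I. \<phi> i (u *\<^sub>R x + v *\<^sub>R y)) \<le> ereal (u * a + v * b)"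
    if "(INF i\<in>I. \<phi> i x) \<le> ereal a" "(INF i\<in>I. \<phi> i y) \<le> ereal b"
      and uv: "0 \<le> u" "0 \<le> v" "u + v = 1" for x y a b u v
  proof (rule ereal_le_epsilon2)
    fix e :: real
    assume "0 < e"
    \<comment> \<open>The strict inequality yields a member of the family below the bound; since u +
      v = 1, the slack e in both heights costs exactly e in the combination.\<close>
    then have "(INF i\<in>I. \<phi> i x) < ereal (a + e)" "(INF i\<in>I. \<phi> i y) < ereal (b + e)"
      using that(1,2) by (auto intro: le_less_trans)
    then obtain i j where ij: "i \<in> I" "\<phi> i x \<le> ereal (a + e)" "j \<in> I" "\<phi> j y \<le> ereal (b + e)"
      by (auto simp: INF_less_iff intro: less_imp_le)
    obtain l where l: "l \<in> I"
      "\<phi> l (u *\<^sub>R x + v *\<^sub>R y) \<le> ereal (u * (a + e) + v * (b + e))"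
      using step[OF ij(1,3,2,4) uv] by blast
    have "u * (a + e) + v * (b + e) = u * a + v * b + (u + v) * e"
      by (simp add: algebra_simps)
    then have "u * (a + e) + v * (b + e) = u * a + v * b + e"
      using uv(3) by simp
    then show "(INF i\<in>I. \<phi> i (u *\<^sub>R x + v *\<^sub>R y)) \<le> ereal (u * a + v * b) + ereal e"
      using l by (auto intro: INF_lower2)
  qed
  then show ?thesis
    by (auto simp: convex_def ereal_epigraph_def)
qed

section \<open>Existence of minimal convex majorants\<close>

lemma minimal_convex_majorantD:
  assumes "minimal_convex_majorant f g"
  shows "convex_majorant f g" "ereal (f x) \<le> g x"
  using assms unfolding minimal_convex_majorant_def convex_majorant_def by blast+

text \<open>Zorn's lemma on the convex majorants below \<open>g0\<close>: the pointwise infimum of a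
  nonempty chain is again one. Convexity survives because the chain is totally ordered, and the
  lower bound \<open>f\<close> keeps the infimum above minus infinity.\<close>

lemma exists_minimal_convex_majorant_le:
  assumes "convex_majorant f g0"
  obtains g where "minimal_convex_majorant f g" "g \<le> g0"
proof -
  define A where "A = {g. convex_majorant f g \<and> g \<le> g0}"
  have "\<exists>m\<in>A. \<forall>a\<in>A. a \<le> m \<longrightarrow> a = m"
  \<comment> \<open>The order is reversed, so that the maximal element supplied by Zorn is minimal
    for the pointwise order.\<close>
  proof (rule predicate_Zorn[of A "\<lambda>a b. b \<le> a"])
    show "partial_order_on A (relation_of (\<lambda>a b. b \<le> a) A)"
      by (rule partial_order_on_relation_ofI) auto
  next
    fix C
    assume "C \<in> Chains (relation_of (\<lambda>a b. b \<le> a) A)"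
    then have CA: "\<And>g. g \<in> C \<Longrightarrow> g \<in> A"
      and ch: "\<And>g h. g \<in> C \<Longrightarrow> h \<in> C \<Longrightarrow> g \<le> h \<or> h \<le> g"
      by (auto simp: Chains_def relation_of_def)
    show "\<exists>m\<in>A. \<forall>a\<in>C. m \<le> a"
    proof (cases "C = {}")
      case True
      then show ?thesis using assms by (auto simp: A_def)
    next
      case False
      then obtain c where c: "c \<in> C" by blast
      define m where "m = (\<lambda>x. INF g\<in>C. g x)"
      have m_le: "m \<le> g" if "g \<in> C" for g
        using that by (auto simp: m_def le_fun_def intro: INF_lower)
      have f_le: "ereal (f x) \<le> m x" for x
        unfolding m_def using CA by (intro INF_greatest) (auto simp: A_def convex_majorant_def)
      have "convex (ereal_epigraph m)"
        unfolding m_def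
      proof (rule convex_ereal_epigraph_INF)
        fix g h x y a b and u v :: real
        assume gh: "g \<in> C" "h \<in> C" "g x \<le> ereal a" "h y \<le> ereal b"
          and uv: "0 \<le> u" "0 \<le> v" "u + v = 1"
        \<comment> \<open>The smaller of the two comparable functions lies below both bounds, so its
          own convexity suffices.\<close>
        from ch[OF gh(1,2)] obtain l where l: "l \<in> C" "l \<le> g" "l \<le> h"
          using gh(1,2) by blast
        have "l x \<le> ereal a" "l y \<le> ereal b"
          using l(2,3) gh(3,4) by (meson le_funD order_trans)+
        moreover have "convex (ereal_epigraph l)"
          using CA[OF l(1)] by (simp add: A_def convex_majorant_def ereal_convex_def)
        ultimately show "\<exists>l\<in>C. l (u *\<^sub>R x + v *\<^sub>R y) \<le> ereal (u * a + v * b)"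
          using convex_ereal_epigraphD uv l(1) by blast
      qed
      moreover have "ereal_epigraph m \<noteq> {}"
      proof -
        have "ereal_epigraph c \<noteq> {}"
          using CA[OF c] by (simp add: A_def convex_majorant_def ereal_convex_def)
        then obtain x \<alpha> where "c x \<le> ereal \<alpha>"
          by (auto simp: ereal_epigraph_def)
        then have "m x \<le> ereal \<alpha>"
          using m_le[OF c] by (meson le_funD order_trans)
        then show ?thesis by (auto simp: ereal_epigraph_def)
      qed
      moreover have "- \<infinity> < m x" for x
        using f_le[of x] by (auto intro: less_le_trans[of _ "ereal (f x)"])
      ultimately have "convex_majorant f m"
        using f_le by (simp add: convex_majorant_def ereal_convex_def)
      moreover have "m \<le> g0"
        using m_le[OF c] CA[OF c] by (auto simp: A_def)
      ultimately show ?thesis using m_le by (auto simp: A_def)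
    qed
  qed
  then obtain m where m: "m \<in> A" "\<And>a. a \<in> A \<Longrightarrow> a \<le> m \<Longrightarrow> a = m" by blast
  have "minimal_convex_majorant f m"
    unfolding minimal_convex_majorant_def
  proof (intro conjI allI impI)
    show "convex_majorant f m" using m(1) by (simp add: A_def)
    \<comment> \<open>Minimality within \<open>A\<close> is minimality among all majorants, since
      anything below \<open>m\<close> is also below \<open>g0\<close>.\<close>
    fix g assume "convex_majorant f g \<and> g \<le> m"
    then show "g = m" using m by (auto simp: A_def)
  qed
  then show thesis using m(1) that by (auto simp: A_def)
qed

lemma exists_minimal_convex_majorant_touching:
  fixes f :: "'a::real_vector \<Rightarrow> real"
  obtains g where "minimal_convex_majorant f g" "g z = ereal (f z)"
proof -
  define g0 :: "'a \<Rightarrow> ereal" where "g0 = (\<lambda>x. if x = z then ereal (f z) else \<infinity>)"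
  \<comment> \<open>The epigraph is a single vertical half-line, which makes its convexity
    immediate.\<close>
  have epi: "ereal_epigraph g0 = {z} \<times> {f z..}"
    by (auto simp: ereal_epigraph_def g0_def split: if_splits)
  have "convex ({z} \<times> {f z..})"
    by (intro convex_Times convex_singleton convex_real_interval)
  then have "convex_majorant f g0"
    unfolding convex_majorant_def ereal_convex_def epi by (simp add: g0_def)
  then obtain g where g: "minimal_convex_majorant f g" "g \<le> g0"
    by (rule exists_minimal_convex_majorant_le)
  have "g z \<le> ereal (f z)"
    using le_funD[OF g(2), of z] by (simp add: g0_def)
  moreover have "ereal (f z) \<le> g z"
    using g(1) by (rule minimal_convex_majorantD)
  ultimately have "g z = ereal (f z)" by (rule antisym)
  with g(1) show thesis by (rule that)
qed

section \<open>Infimal convolution with a multiple of the norm\<close>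

lemma convex_majorant_inf_convolution:
  fixes f :: "'a::real_normed_vector \<Rightarrow> real"
  assumes f: "k-lipschitz_on UNIV f" and g: "convex_majorant f g"
  shows "convex_majorant f (\<lambda>x. INF y. g y + ereal (k * norm (x - y)))"
    (is "convex_majorant f ?h")
proof -
  have k: "0 \<le> k" using lipschitz_on_nonneg[OF f] .
  have fg: "ereal (f x) \<le> g x" for x
    using g by (simp add: convex_majorant_def)
  have cg: "convex (ereal_epigraph g)" and ne: "ereal_epigraph g \<noteq> {}"
    using g by (simp_all add: convex_majorant_def ereal_convex_def)
  have fh: "ereal (f x) \<le> ?h x" for x
  proof (rule INF_greatest)
    fix y
    have "f x \<le> f y + k * norm (x - y)"
      using lipschitz_onD[OF f, of x y] by (simp add: dist_norm abs_le_iff)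
    then have "ereal (f x) \<le> ereal (f y) + ereal (k * norm (x - y))" by simp
    also have "\<dots> \<le> g y + ereal (k * norm (x - y))"
      by (intro add_right_mono fg)
    finally show "ereal (f x) \<le> g y + ereal (k * norm (x - y))" .
  qed
  \<comment> \<open>The function g y + k * norm (x - y) is jointly convex in (x, y), and minimizing
    over y preserves convexity.\<close>
  have "convex (ereal_epigraph ?h)"
  proof (rule convex_ereal_epigraph_INF)
    fix y y' x x' :: 'a and a b u v :: real
    assume 1: "g y + ereal (k * norm (x - y)) \<le> ereal a"
      and 2: "g y' + ereal (k * norm (x' - y')) \<le> ereal b"
      and uv: "0 \<le> u" "0 \<le> v" "u + v = 1"
    \<comment> \<open>The base points are combined with the same weights as x and x', so the
      triangle inequality bounds the new norm term.\<close>
    define w where "w = u *\<^sub>R y + v *\<^sub>R y'"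
    have "g y \<le> ereal (a - k * norm (x - y))"
      using 1 by (cases "g y") (auto simp: algebra_simps)
    moreover have "g y' \<le> ereal (b - k * norm (x' - y'))"
      using 2 by (cases "g y'") (auto simp: algebra_simps)
    ultimately have gw: "g w \<le> ereal (u * (a - k * norm (x - y)) + v * (b - k * norm (x' - y')))"
      unfolding w_def using convex_ereal_epigraphD[OF cg] uv by blast
    have "norm (u *\<^sub>R x + v *\<^sub>R x' - w) = norm (u *\<^sub>R (x - y) + v *\<^sub>R (x' - y'))"
      by (simp add: w_def algebra_simps)
    also have "\<dots> \<le> u * norm (x - y) + v * norm (x' - y')"
      using uv by (metis abs_of_nonneg norm_scaleR norm_triangle_ineq)
    finally have "k * norm (u *\<^sub>R x + v *\<^sub>R x' - w) \<le> k * (u * norm (x - y) + v * norm (x' - y'))"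
      using k by (rule mult_left_mono)
    then have "u * (a - k * norm (x - y)) + v * (b - k * norm (x' - y'))
        + k * norm (u *\<^sub>R x + v *\<^sub>R x' - w) \<le> u * a + v * b"
      by (simp add: algebra_simps)
    then have "g w + ereal (k * norm (u *\<^sub>R x + v *\<^sub>R x' - w)) \<le> ereal (u * a + v * b)"
      using gw by (cases "g w") auto
    then show "\<exists>l\<in>UNIV. g l + ereal (k * norm (u *\<^sub>R x + v *\<^sub>R x' - l)) \<le> ereal (u * a + v * b)"
      by blast
  qed
  moreover have "ereal_epigraph ?h \<noteq> {}"
  proof -
    obtain x \<alpha> where "g x \<le> ereal \<alpha>"
      using ne by (auto simp: ereal_epigraph_def)
    then have "?h x \<le> ereal \<alpha>" by (intro INF_lower2[of x]) auto
    then show ?thesis by (auto simp: ereal_epigraph_def)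
  qed
  moreover have "- \<infinity> < ?h x" for x
    using fh[of x] by (auto intro: less_le_trans[of _ "ereal (f x)"])
  ultimately show ?thesis
    using fh by (simp add: convex_majorant_def ereal_convex_def)
qed

lemma minimal_convex_majorant_lipschitz:
  fixes f :: "'a::real_normed_vector \<Rightarrow> real"
  assumes f: "k-lipschitz_on UNIV f" and g: "minimal_convex_majorant f g"
  shows "real_valued_lipschitz_le k g"
proof -
  have cm: "convex_majorant f g"
    using g by (rule minimal_convex_majorantD)
  \<comment> \<open>The choice y = x makes the norm term vanish.\<close>
  have "(\<lambda>x. INF y. g y + ereal (k * norm (x - y))) \<le> g"
  proof (rule le_funI)
    show "(INF y. g y + ereal (k * norm (x - y))) \<le> g x" for x
      by (rule INF_lower2[of x]) simp_all
  qed
  then have eq: "(\<lambda>x. INF y. g y + ereal (k * norm (x - y))) = g"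
    using g convex_majorant_inf_convolution[OF f cm]
    unfolding minimal_convex_majorant_def by blast
  \<comment> \<open>Only the occurrence of \<open>g\<close> at x is unfolded into the infimum, which
    is at most its term with index y.\<close>
  have le: "g x \<le> g y + ereal (k * norm (x - y))" for x y
    by (subst (1) eq[symmetric]) (rule INF_lower[OF UNIV_I])
  obtain z \<alpha> where z: "g z \<le> ereal \<alpha>"
    using cm by (auto simp: convex_majorant_def ereal_convex_def ereal_epigraph_def)
  have "\<bar>g x\<bar> \<noteq> \<infinity>" for x
  proof -
    have "g x \<noteq> - \<infinity>"
      using cm by (auto simp: convex_majorant_def ereal_convex_def)
    \<comment> \<open>Finiteness at the single point z spreads to every x through
      \<open>le\<close>.\<close>
    moreover have "g x \<noteq> \<infinity>"
      using le[of x z] z by (cases "g z") auto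
    ultimately show ?thesis by (cases "g x") auto
  qed
  then have r: "g x = ereal (real_of_ereal (g x))" for x
    by (simp add: ereal_real)
  have "real_of_ereal (g x) \<le> real_of_ereal (g y) + k * norm (x - y)" for x y
    using le[of x y] r[of x] r[of y] by (metis ereal_less_eq(3) plus_ereal.simps(1))
  then have "k-lipschitz_on UNIV (\<lambda>x. real_of_ereal (g x))"
    by (intro lipschitz_onI lipschitz_on_nonneg[OF f])
       (smt (verit) dist_norm norm_minus_commute real_norm_def)
  then show ?thesis
    unfolding real_valued_lipschitz_le_def
    using r by (intro exI[of _ "\<lambda>x. real_of_ereal (g x)"] conjI allI exI[of _ k]) auto
qed

text \<open>For the converse, a majorant r with r z = f z gives f x \<le> r x \<le> f z + k * dist x
  z. The majorant varies with z, and exchanging the two points gives the other half of the Lipschitz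
  bound.\<close>

lemma lipschitz_iff_minimal_convex_majorants:
  fixes f :: "'a::real_normed_vector \<Rightarrow> real"
  assumes "k \<ge> 0"
  shows "k-lipschitz_on UNIV f \<longleftrightarrow>
    (\<forall>g. minimal_convex_majorant f g \<longrightarrow> real_valued_lipschitz_le k g)"
proof
  assume *: "\<forall>g. minimal_convex_majorant f g \<longrightarrow> real_valued_lipschitz_le k g"
  have le: "f x \<le> f z + k * dist x z" for x z
  proof -
    obtain g where g: "minimal_convex_majorant f g" "g z = ereal (f z)"
      by (rule exists_minimal_convex_majorant_touching)
    with * obtain r L where r: "\<And>x. g x = ereal (r x)" and L: "L \<le> k" "L-lipschitz_on UNIV r"
      unfolding real_valued_lipschitz_le_def by blast
    have "f x \<le> r x"
      using minimal_convex_majorantD(2)[OF g(1), of x] r by simp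
    moreover have "r z = f z" using g(2) r by simp
    moreover have "dist (r x) (r z) \<le> k * dist x z"
      using lipschitz_onD[OF lipschitz_on_le[OF L(2,1)]] by simp
    ultimately show ?thesis by (simp add: dist_real_def abs_le_iff)
  qed
  show "k-lipschitz_on UNIV f"
  proof (rule lipschitz_onI[OF _ assms])
    show "dist (f x) (f y) \<le> k * dist x y" for x y
      using le[of x y] le[of y x] by (simp add: dist_real_def dist_commute abs_le_iff)
  qed
qed (use minimal_convex_majorant_lipschitz in blast)

section \<open>Passage to concave minorants by negation\<close>

lemma maximal_concave_minorant_iff:
  "maximal_concave_minorant f h \<longleftrightarrow> minimal_convex_majorant (\<lambda>x. - f x) (\<lambda>x. - h x)"
proof -
  have cm: "concave_minorant f h \<longleftrightarrow> convex_majorant (\<lambda>x. - f x) (\<lambda>x. - h x)" for h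
    unfolding concave_minorant_def convex_majorant_def ereal_concave_def
    by (metis ereal_minus_le_minus uminus_ereal.simps(1))
  \<comment> \<open>Negation is an involution on extended-real functions, so competitors h' may be
    replaced by their negatives.\<close>
  have neg: "(\<forall>h'. P h') \<longleftrightarrow> (\<forall>h'. P (\<lambda>x. - h' x))" for P :: "('a \<Rightarrow> ereal) \<Rightarrow> bool"
  proof
    assume *: "\<forall>h'. P (\<lambda>x. - h' x)"
    show "\<forall>h'. P h'"
    proof
      fix h' show "P h'" using *[rule_format, of "\<lambda>x. - h' x"] by simp
    qed
  qed blast
  show ?thesis
    unfolding maximal_concave_minorant_def minimal_convex_majorant_def cm
    by (subst neg) (auto simp: le_fun_def fun_eq_iff ereal_uminus_eq_reorder ereal_uminus_le_reorder)
qed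

lemma real_valued_lipschitz_le_uminus:
  assumes "real_valued_lipschitz_le k g"
  shows "real_valued_lipschitz_le k (\<lambda>x. - g x)"
proof -
  obtain r L where "\<And>x. g x = ereal (r x)" "L \<le> k" "L-lipschitz_on UNIV r"
    using assms unfolding real_valued_lipschitz_le_def by blast
  then show ?thesis
    unfolding real_valued_lipschitz_le_def
    by (intro exI[of _ "\<lambda>x. - r x"]) auto
qed

lemma real_valued_lipschitz_le_uminus_iff:
  "real_valued_lipschitz_le k (\<lambda>x. - g x) \<longleftrightarrow> real_valued_lipschitz_le k g"
  using real_valued_lipschitz_le_uminus[of k g] real_valued_lipschitz_le_uminus[of k "\<lambda>x. - g x"]
  by auto

theorem theorem4p1:
  fixes f :: "'a::real_normed_vector \<Rightarrow> real" and k :: real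
  assumes "k > 0"
  shows "(k-lipschitz_on UNIV f \<longleftrightarrow>
            (\<forall>g. minimal_convex_majorant f g \<longrightarrow> real_valued_lipschitz_le k g)) \<and>
         (k-lipschitz_on UNIV f \<longleftrightarrow>
            (\<forall>h. maximal_concave_minorant f h \<longrightarrow> real_valued_lipschitz_le k h))"
proof -
  have k: "0 \<le> k" using assms by simp
  \<comment> \<open>The concave statement for \<open>f\<close> is the convex statement for its
    negative, whose Lipschitz constants are the same.\<close>
  have "k-lipschitz_on UNIV f \<longleftrightarrow> k-lipschitz_on UNIV (\<lambda>x. - f x)"
    by simp
  also have "\<dots> \<longleftrightarrow> (\<forall>h. minimal_convex_majorant (\<lambda>x. - f x) h \<longrightarrow> real_valued_lipschitz_le k h)"
    by (rule lipschitz_iff_minimal_convex_majorants[OF k])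
  also have "\<dots> \<longleftrightarrow> (\<forall>h. maximal_concave_minorant f h \<longrightarrow> real_valued_lipschitz_le k h)"
  proof (intro iffI allI impI)
    fix h
    assume "\<forall>h. minimal_convex_majorant (\<lambda>x. - f x) h \<longrightarrow> real_valued_lipschitz_le k h"
      and "maximal_concave_minorant f h"
    then show "real_valued_lipschitz_le k h"
      using maximal_concave_minorant_iff real_valued_lipschitz_le_uminus_iff by blast
  next
    fix h
    assume *: "\<forall>h. maximal_concave_minorant f h \<longrightarrow> real_valued_lipschitz_le k h"
      and "minimal_convex_majorant (\<lambda>x. - f x) h"
    then have "maximal_concave_minorant f (\<lambda>x. - h x)"
      by (simp add: maximal_concave_minorant_iff)
    then show "real_valued_lipschitz_le k h"
      using * real_valued_lipschitz_le_uminus_iff by blast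
  qed
  finally show ?thesis
    using lipschitz_iff_minimal_convex_majorants[OF k] by blast
qed

end
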